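(* Let $X$ and $\Xi$ be compact metric spaces, let $\tau:\Xi\to\Xi$ be a minimal equicontinuous homeomorphism, and let the homeomorphism $f:X\to X$ be a regular almost 1-1 extension of $\tau$. Then $\sup_{n\in\mathbb{N}}\hat S_n(f,\delta)<\infty$ for all $\delta>0$, and in particular $h_{\mathrm{mod}}(f)=0$.
   Context: $f:X\to X$ is a (topological) extension of $\tau:\Xi\to\Xi$ if there is a continuous surjective map $h:X\to\Xi$ (a factor map) with $h\circ f=\tau\circ h$; factor maps of extensions are implicitly assumed not to be injective. The extension is almost 1-1 if the set $\Omega=\{\xi\in\Xi\mid \#h^{-1}(\xi)=1\}$ is residual in $\Xi$. A homeomorphism $\tau$ is equicontinuous (almost periodic) if the family of its iterates is equicontinuous. Since $\tau$ is minimal and equicontinuous, it has a unique invariant Borel probability measure $\mu$, which is ergodic. The almost 1-1 extension is called regular if $\mu(\Omega)=1$. With $d$ the metric on $X$ and $n\ge1$, the Hamming metric is $\hat d_n^f(x,y)=\frac1n\sum_{i=0}^{n-1}d(f^i(x),f^i(y))$. $\hat S_n(f,\delta)$ denotes the maximal cardinality of a set $S\subseteq X$ that is $\delta$-separated with respect to $\hat d_n^f$, i.e. $\hat d_n^f(x,y)\geq\delta$ for all $x\neq y$ in $S$. The modified power entropy of $f$ is $h_{\mathrm{mod}}(f)=\lim_{\delta\to0}\lim_{n\to\infty}\frac{\log\hat S_n(f,\delta)}{\log n}$ (provided the limits as $n\to\infty$ exist). *)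

theory Defs
  imports "HOL-Probability.Probability" "HOL-Library.Extended_Nat"
begin

text \<open>Spaces are carrier sets inside metric-space types, with the restricted metric, the
  subspace topology and the trace Borel sigma-algebra; maps matter only on their carriers.\<close>

definition self_homeomorphism :: "'a::topological_space set \<Rightarrow> ('a \<Rightarrow> 'a) \<Rightarrow> bool" where
  "self_homeomorphism X f \<longleftrightarrow> (\<exists>g. homeomorphism X X f g)"

definition minimal_on :: "'a::topological_space set \<Rightarrow> ('a \<Rightarrow> 'a) \<Rightarrow> bool" where
  "minimal_on X f \<longleftrightarrow> X \<noteq> {} \<and>
     (\<forall>A. closedin (top_of_set X) A \<and> A \<noteq> {} \<and> f ` A \<subseteq> A \<longrightarrow> A = X)"

definition equicontinuous_map_on :: "'a::metric_space set \<Rightarrow> ('a \<Rightarrow> 'a) \<Rightarrow> bool" where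
  "equicontinuous_map_on X f \<longleftrightarrow>
     (\<forall>x\<in>X. \<forall>e>0. \<exists>d>0. \<forall>y\<in>X. dist y x < d \<longrightarrow>
        (\<forall>n. dist ((f ^^ n) y) ((f ^^ n) x) < e))"

definition residual_in :: "'a::topological_space set \<Rightarrow> 'a set \<Rightarrow> bool" where
  "residual_in X R \<longleftrightarrow> R \<subseteq> X \<and>
     (\<exists>U :: nat \<Rightarrow> 'a set.
        (\<forall>n. openin (top_of_set X) (U n) \<and> X \<subseteq> closure (U n)) \<and> (\<Inter>n. U n) \<subseteq> R)"

text \<open>\<open>factor_map X f Y t h\<close>: the system \<open>(X, f)\<close> is an extension of \<open>(Y, t)\<close> via \<open>h\<close>.
  By convention, factor maps of extensions are not injective.\<close>

definition factor_map ::
  "'a::topological_space set \<Rightarrow> ('a \<Rightarrow> 'a) \<Rightarrow> 'b::topological_space set \<Rightarrow> ('b \<Rightarrow> 'b) \<Rightarrow> ('a \<Rightarrow> 'b) \<Rightarrow> bool"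
  where
  "factor_map X f Y t h \<longleftrightarrow>
     continuous_on X h \<and> h ` X = Y \<and> (\<forall>x\<in>X. h (f x) = t (h x)) \<and> \<not> inj_on h X"

definition singleton_fibres :: "'a set \<Rightarrow> 'b set \<Rightarrow> ('a \<Rightarrow> 'b) \<Rightarrow> 'b set" where
  "singleton_fibres X Y h = {y \<in> Y. card {x \<in> X. h x = y} = 1}"

definition almost_1_1_extension ::
  "'a::topological_space set \<Rightarrow> ('a \<Rightarrow> 'a) \<Rightarrow> 'b::topological_space set \<Rightarrow> ('b \<Rightarrow> 'b) \<Rightarrow> ('a \<Rightarrow> 'b) \<Rightarrow> bool"
  where
  "almost_1_1_extension X f Y t h \<longleftrightarrow>
     factor_map X f Y t h \<and> residual_in Y (singleton_fibres X Y h)"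

definition invariant_borel_prob ::
  "'a::topological_space set \<Rightarrow> ('a \<Rightarrow> 'a) \<Rightarrow> 'a measure \<Rightarrow> bool" where
  "invariant_borel_prob X f M \<longleftrightarrow>
     prob_space M \<and> sets M = sets (restrict_space borel X) \<and> distr M M f = M"

text \<open>Here \<open>M\<close> is meant to be the unique invariant Borel probability measure of \<open>(Y, t)\<close>.\<close>

definition regular_almost_1_1_extension ::
  "'a::topological_space set \<Rightarrow> ('a \<Rightarrow> 'a) \<Rightarrow> 'b::topological_space set \<Rightarrow> ('b \<Rightarrow> 'b) \<Rightarrow> 'b measure
     \<Rightarrow> ('a \<Rightarrow> 'b) \<Rightarrow> bool" where
  "regular_almost_1_1_extension X f Y t M h \<longleftrightarrow>
     almost_1_1_extension X f Y t h \<and> measure M (singleton_fibres X Y h) = 1"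

definition hamming_dist :: "('a::metric_space \<Rightarrow> 'a) \<Rightarrow> nat \<Rightarrow> 'a \<Rightarrow> 'a \<Rightarrow> real" where
  "hamming_dist f n x y = (\<Sum>i<n. dist ((f ^^ i) x) ((f ^^ i) y)) / real n"

definition hamming_separated ::
  "'a::metric_space set \<Rightarrow> ('a \<Rightarrow> 'a) \<Rightarrow> nat \<Rightarrow> real \<Rightarrow> 'a set \<Rightarrow> bool" where
  "hamming_separated X f n \<delta> S \<longleftrightarrow>
     S \<subseteq> X \<and> (\<forall>x\<in>S. \<forall>y\<in>S. x \<noteq> y \<longrightarrow> hamming_dist f n x y \<ge> \<delta>)"

text \<open>The maximal cardinality is taken in the extended naturals, so that finiteness is not
  built into the definition.\<close>

definition hamming_sep_number ::
  "'a::metric_space set \<Rightarrow> ('a \<Rightarrow> 'a) \<Rightarrow> nat \<Rightarrow> real \<Rightarrow> enat" where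
  "hamming_sep_number X f n \<delta> =
     (SUP S \<in> {S. hamming_separated X f n \<delta> S}. if finite S then enat (card S) else \<infinity>)"

definition ln_enat :: "enat \<Rightarrow> ereal" where
  "ln_enat k = (case k of enat m \<Rightarrow> ereal (ln (real m)) | \<infinity> \<Rightarrow> \<infinity>)"

text \<open>\<open>has_mod_power_entropy X f L\<close>: the modified power entropy of \<open>f\<close> on \<open>X\<close> exists and equals
  \<open>L\<close>. The function \<open>g\<close> collects the inner limits, which must exist for every \<open>\<delta> > 0\<close>.\<close>

definition has_mod_power_entropy ::
  "'a::metric_space set \<Rightarrow> ('a \<Rightarrow> 'a) \<Rightarrow> ereal \<Rightarrow> bool" where
  "has_mod_power_entropy X f L \<longleftrightarrow>
     (\<exists>g :: real \<Rightarrow> ereal.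
        (\<forall>\<delta>>0. (\<lambda>n. ln_enat (hamming_sep_number X f n \<delta>) / ereal (ln (real n)))
                 \<longlonglongrightarrow> g \<delta>) \<and>
        (g \<longlongrightarrow> L) (at_right 0))"

end

theory Submission
  imports Defs
begin

text \<open>Let \<open>B\<close> be the set of \<open>\<xi>\<close> for which there are \<open>x, y\<close> at distance at least \<open>\<delta>/4\<close> with both
  \<open>h x\<close> and \<open>h y\<close> in the \<open>\<rho>\<close>-ball around \<open>\<xi>\<close>. Regularity makes \<open>\<mu> B\<close> small for small \<open>\<rho>\<close>. By
  invariance, for each \<open>n\<close> some \<open>\<xi>\<close> visits \<open>B\<close> at most \<open>n \<mu>(B)\<close> times before time \<open>n\<close>. If \<open>h x\<close> and
  \<open>h y\<close> are close, then minimality and equicontinuity let \<open>\<tau>\<^sup>k \<xi>\<close> shadow both of their orbits forever,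
  for some \<open>k\<close> bounded independently of \<open>n\<close>. So \<open>f\<^sup>i x\<close> and \<open>f\<^sup>i y\<close> are far apart for at most
  \<open>n \<mu>(B) + k\<close> times \<open>i < n\<close>, and for large \<open>n\<close> the Hamming distance is below \<open>\<delta>\<close>. Hence a separated
  set has at most one point over each cell of a fixed finite cover of \<open>\<Xi>\<close>. Neither the ergodic
  theorem nor unique ergodicity is needed.\<close>

section \<open>Iterates of a self-map of a carrier set\<close>

lemma funpow_image_subset: "g ` A \<subseteq> A \<Longrightarrow> (g ^^ n) ` A \<subseteq> A"
  by (induction n) auto

lemma funpow_mem: "g ` A \<subseteq> A \<Longrightarrow> x \<in> A \<Longrightarrow> (g ^^ n) x \<in> A"
  using funpow_image_subset[of g A n] by blast

lemma continuous_on_funpow: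
  assumes "continuous_on A g" "g ` A \<subseteq> A"
  shows "continuous_on A (g ^^ n)"
proof (induction n)
  case 0
  then show ?case by (simp add: id_def)
next
  case (Suc n)
  have "continuous_on ((g ^^ n) ` A) g"
    using assms funpow_image_subset[of g A n] continuous_on_subset by blast
  with Suc show ?case
    by (simp add: continuous_on_compose o_def[symmetric] del: o_apply)
qed

lemma self_homeomorphismD:
  assumes "self_homeomorphism X f"
  shows "continuous_on X f" "f ` X \<subseteq> X"
  using assms by (auto simp: self_homeomorphism_def homeomorphism_def)

section \<open>Shadowing of orbits under equicontinuity and minimality\<close>

text \<open>The bound is strict at each time, so the supremum of the distances along the two orbits
  may still equal \<open>e\<close>.\<close>

definition orbit_close :: "('a::metric_space \<Rightarrow> 'a) \<Rightarrow> real \<Rightarrow> 'a \<Rightarrow> 'a \<Rightarrow> bool" where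
  "orbit_close t e x y \<longleftrightarrow> (\<forall>n. dist ((t ^^ n) x) ((t ^^ n) y) < e)"

lemma orbit_closeD: "orbit_close t e x y \<Longrightarrow> dist ((t ^^ n) x) ((t ^^ n) y) < e"
  by (simp add: orbit_close_def)

lemma orbit_close_trans:
  assumes "orbit_close t a x y" "orbit_close t b y z" "a + b \<le> c"
  shows "orbit_close t c x z"
  unfolding orbit_close_def
proof
  fix n
  show "dist ((t ^^ n) x) ((t ^^ n) z) < c"
    using dist_triangle[of "(t ^^ n) x" "(t ^^ n) z" "(t ^^ n) y"]
      orbit_closeD[OF assms(1), of n] orbit_closeD[OF assms(2), of n] assms(3) by linarith
qed

lemma orbit_close_funpow:
  assumes "orbit_close t e x y"
  shows "orbit_close t e ((t ^^ k) x) ((t ^^ k) y)"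
  unfolding orbit_close_def
proof
  fix n
  show "dist ((t ^^ n) ((t ^^ k) x)) ((t ^^ n) ((t ^^ k) y)) < e"
    using orbit_closeD[OF assms, of "n + k"] by (simp add: funpow_add)
qed

text \<open>Compactness turns pointwise equicontinuity of the family of all iterates into uniform
  equicontinuity.\<close>

lemma equicontinuous_map_on_uniform:
  assumes "compact X" "equicontinuous_map_on X t" "e > 0"
  obtains d where "d > 0" "\<And>x y. x \<in> X \<Longrightarrow> y \<in> X \<Longrightarrow> dist x y < d \<Longrightarrow> orbit_close t e x y"
proof (rule compact_uniformly_equicontinuous[OF \<open>compact X\<close> _ \<open>e > 0\<close>, of "range (\<lambda>n. t ^^ n)"])
  show "\<exists>\<delta>>0. \<forall>f\<in>range (\<lambda>n. t ^^ n). \<forall>x'\<in>X. dist x' x < \<delta> \<longrightarrow> dist (f x') (f x) < \<epsilon>"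
    if "x \<in> X" "0 < \<epsilon>" for x \<epsilon>
  proof -
    obtain d where "d > 0" "\<forall>y\<in>X. dist y x < d \<longrightarrow> (\<forall>n. dist ((t ^^ n) y) ((t ^^ n) x) < \<epsilon>)"
      using assms(2) \<open>x \<in> X\<close> \<open>0 < \<epsilon>\<close> unfolding equicontinuous_map_on_def by blast
    then show ?thesis by (intro exI[of _ d]) auto
  qed
next
  fix d
  assume "0 < d" and "\<And>f x x'. f \<in> range (\<lambda>n. t ^^ n) \<Longrightarrow> x \<in> X \<Longrightarrow> x' \<in> X \<Longrightarrow>
    dist x' x < d \<Longrightarrow> dist (f x') (f x) < e"
  then show thesis
    by (intro that[of d]) (auto simp: orbit_close_def)
qed

text \<open>By continuity of \<open>t\<close>, the closure of the forward orbit of \<open>x\<close>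
  in \<open>X\<close> is forward invariant; it is closed and nonempty, so minimality makes it all of
  \<open>X\<close>.\<close>

lemma minimal_on_orbit_dense:
  assumes "minimal_on X t" "continuous_on X t" "t ` X \<subseteq> X" "x \<in> X" "y \<in> X" "r > 0"
  obtains k where "dist ((t ^^ k) x) y < r"
proof -
  define A where "A = X \<inter> closure (range (\<lambda>n. (t ^^ n) x))"
  have mem: "(t ^^ n) x \<in> X" for n
    using funpow_mem[OF assms(3,4)] .
  have orb: "(t ^^ n) x \<in> A" for n
    using mem closure_subset[of "range (\<lambda>n. (t ^^ n) x)"] by (auto simp: A_def)
  have "t a \<in> A" if "a \<in> A" for a
  proof -
    from that have "a \<in> X" and cl: "a \<in> closure (range (\<lambda>n. (t ^^ n) x))"
      by (auto simp: A_def)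
    have "\<exists>u\<in>range (\<lambda>n. (t ^^ n) x). dist u (t a) < e" if "e > 0" for e
    proof -
      obtain d where "d > 0" and d: "\<forall>z\<in>X. dist z a < d \<longrightarrow> dist (t z) (t a) < e"
        using assms(2) \<open>a \<in> X\<close> \<open>e > 0\<close> unfolding continuous_on_iff by meson
      obtain n where "dist ((t ^^ n) x) a < d"
        using cl \<open>d > 0\<close> by (auto simp: closure_approachable)
      then have "dist ((t ^^ Suc n) x) (t a) < e"
        using d mem by simp
      then show ?thesis by blast
    qed
    then show ?thesis
      using \<open>a \<in> X\<close> assms(3) by (auto simp: A_def closure_approachable)
  qed
  then have "t ` A \<subseteq> A" by blast
  moreover have "closedin (top_of_set X) A"
    by (simp add: A_def closedin_closed_Int)
  moreover have "A \<noteq> {}" using orb by blast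
  ultimately have "A = X"
    using assms(1) by (simp add: minimal_on_def)
  then have "y \<in> closure (range (\<lambda>n. (t ^^ n) x))"
    using \<open>y \<in> X\<close> by (auto simp: A_def)
  then show thesis
    using that \<open>r > 0\<close> by (auto simp: closure_approachable)
qed

text \<open>Only the travel times between points of a finite net have to be bounded. With net points
  \<open>p\<close> near \<open>x\<close> and \<open>q\<close> near \<open>y\<close>, the orbit of
  \<open>x\<close> shadows that of \<open>p\<close>, which comes near \<open>q\<close>, which
  shadows \<open>y\<close>; each comparison costs \<open>e / 3\<close>.\<close>

lemma minimal_equicontinuous_uniform_return:
  assumes "compact X" "minimal_on X t" "equicontinuous_map_on X t"
    "continuous_on X t" "t ` X \<subseteq> X" "e > 0"
  obtains K where
    "\<And>x y. x \<in> X \<Longrightarrow> y \<in> X \<Longrightarrow> \<exists>k\<le>K. orbit_close t e ((t ^^ k) x) y"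
proof -
  have "e / 3 > 0" using assms(6) by simp
  then obtain d where "d > 0"
    and d: "\<And>x y. x \<in> X \<Longrightarrow> y \<in> X \<Longrightarrow> dist x y < d \<Longrightarrow> orbit_close t (e / 3) x y"
    using equicontinuous_map_on_uniform[OF assms(1,3)] by blast
  obtain P where P: "finite P" "P \<subseteq> X" "X \<subseteq> (\<Union>p\<in>P. ball p d)"
    using seq_compact_imp_totally_bounded[OF compact_imp_seq_compact[OF assms(1)],
        rule_format, OF \<open>d > 0\<close>] by auto
  have "\<exists>k. dist ((t ^^ k) p) q < d" if "p \<in> P" "q \<in> P" for p q
    using minimal_on_orbit_dense[OF assms(2,4,5) _ _ \<open>d > 0\<close>, of p q] that P(2) by (meson subsetD)
  then obtain k where k: "\<And>p q. p \<in> P \<Longrightarrow> q \<in> P \<Longrightarrow> dist ((t ^^ k p q) p) q < d"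
    by metis
  \<comment> \<open>Any common bound of these finitely many times will do, and a sum of naturals
    dominates each summand.\<close>
  define K where "K = (\<Sum>(p, q)\<in>P \<times> P. k p q)"
  have kK: "k p q \<le> K" if "p \<in> P" "q \<in> P" for p q
    unfolding K_def using member_le_sum[of "(p, q)" "P \<times> P" "\<lambda>(p, q). k p q"] that P(1) by auto
  show thesis
  proof (rule that[of K])
    fix x y assume "x \<in> X" "y \<in> X"
    obtain p where p: "p \<in> P" "dist p x < d" using P(3) \<open>x \<in> X\<close> by auto
    obtain q where q: "q \<in> P" "dist q y < d" using P(3) \<open>y \<in> X\<close> by auto
    have "orbit_close t (e / 3) x p"
      using d[of x p] p P(2) \<open>x \<in> X\<close> by (auto simp: dist_commute)
    then have "orbit_close t (e / 3) ((t ^^ k p q) x) ((t ^^ k p q) p)"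
      by (rule orbit_close_funpow)
    moreover have "orbit_close t (e / 3) ((t ^^ k p q) p) q"
      using d k p(1) q(1) P(2) funpow_mem[OF assms(5)] by blast
    ultimately have "orbit_close t (2 * e / 3) ((t ^^ k p q) x) q"
      by (rule orbit_close_trans) simp
    moreover have "orbit_close t (e / 3) q y"
      using d q P(2) \<open>y \<in> X\<close> by blast
    ultimately have "orbit_close t e ((t ^^ k p q) x) y"
      by (rule orbit_close_trans) simp
    then show "\<exists>k\<le>K. orbit_close t e ((t ^^ k) x) y"
      using kK p(1) q(1) by blast
  qed
qed

section \<open>Visit counts under an invariant measure\<close>

text \<open>By invariance each time \<open>i\<close> contributes \<open>prob B\<close> to the mean
  of the visit count, and a function cannot exceed its mean everywhere.\<close>

lemma (in prob_space) exists_visit_count_le_measure: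
  assumes t: "t \<in> measurable M M" "distr M M t = M" and B: "B \<in> sets M"
  obtains x where "x \<in> space M" "real (card {i. i < n \<and> (t ^^ i) x \<in> B}) \<le> real n * prob B"
proof -
  have tn: "t ^^ i \<in> measurable M M" for i
    by (induction i) (auto simp: id_def intro: measurable_compose[OF _ t(1)])
  have dtn: "distr M M (t ^^ i) = M" for i
  proof (induction i)
    case 0
    then show ?case by (simp add: id_def distr_id)
  next
    case (Suc i)
    then show ?case using distr_distr[OF t(1) tn[of i]] t(2) by (simp add: o_def)
  qed
  define N where "N x = (\<Sum>i<n. indicator B ((t ^^ i) x) :: real)" for x
  have N: "N x = real (card {i. i < n \<and> (t ^^ i) x \<in> B})" for x
  proof -
    have "N x = (\<Sum>i | i < n \<and> (t ^^ i) x \<in> B. 1)"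
      unfolding N_def by (rule sum.mono_neutral_cong_right) (auto simp: indicator_def)
    then show ?thesis by simp
  qed
  have int: "integrable M (\<lambda>x. indicator B ((t ^^ i) x) :: real)" for i
    using integrable_distr[OF tn[of i], of "indicator B :: _ \<Rightarrow> real"] B dtn[of i]
    by (simp add: integrable_real_indicator less_top[symmetric])
  have "expectation (\<lambda>x. indicator B ((t ^^ i) x)) = prob B" for i
    using integral_distr[OF tn[of i], of "indicator B :: _ \<Rightarrow> real"] B dtn[of i] by simp
  then have "expectation N = real n * prob B"
    unfolding N_def using int by (simp add: Bochner_Integration.integral_sum)
  moreover have "integrable M N"
    unfolding N_def using int by (intro Bochner_Integration.integrable_sum)
  ultimately have "\<exists>x\<in>space M. N x \<le> real n * prob B"
    using expectation_greater[of N "real n * prob B"] AE_I2[of M "\<lambda>x. real n * prob B < N x"]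
    by (metis less_irrefl not_le)
  then show thesis using that N by auto
qed

section \<open>Bounding separated sets by covers\<close>

text \<open>Two points of a separated set cannot share a cell, so choosing a cell for each point is
  injective.\<close>

lemma hamming_sep_number_le_card_cover:
  assumes "finite P" "X \<subseteq> (\<Union>p\<in>P. C p)"
    and small: "\<And>p x y. p \<in> P \<Longrightarrow> x \<in> X \<inter> C p \<Longrightarrow> y \<in> X \<inter> C p \<Longrightarrow> hamming_dist f n x y < \<delta>"
  shows "hamming_sep_number X f n \<delta> \<le> enat (card P)"
  unfolding hamming_sep_number_def
proof (rule SUP_least)
  fix S assume "S \<in> {S. hamming_separated X f n \<delta> S}"
  then have S: "S \<subseteq> X" "\<And>x y. x \<in> S \<Longrightarrow> y \<in> S \<Longrightarrow> x \<noteq> y \<Longrightarrow> \<delta> \<le> hamming_dist f n x y"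
    by (auto simp: hamming_separated_def)
  have "\<forall>x\<in>S. \<exists>p. p \<in> P \<and> x \<in> C p" using S(1) assms(2) by blast
  then obtain c where c: "\<And>x. x \<in> S \<Longrightarrow> c x \<in> P \<and> x \<in> C (c x)" by metis
  have "inj_on c S"
  proof (rule inj_onI, rule ccontr)
    fix x y assume "x \<in> S" "y \<in> S" "c x = c y" "x \<noteq> y"
    then show False
      using small[of "c x" x y] c[of x] c[of y] S by fastforce
  qed
  moreover have "c ` S \<subseteq> P" using c by blast
  ultimately show "(if finite S then enat (card S) else \<infinity>) \<le> enat (card P)"
    using card_inj_on_le[of c S P] inj_on_finite[of c S P] assms(1) by auto
qed

text \<open>The cells are preimages of balls covering the compact image. \<open>L\<close> is fixed
  before \<open>n\<close>, so it can bound all large \<open>n\<close> at once. Taking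
  \<open>\<phi>\<close> to be the factor map treats large \<open>n\<close>; the identity treats a
  single \<open>n\<close>.\<close>

lemma hamming_sep_number_bounded_via:
  fixes \<phi> :: "'a::metric_space \<Rightarrow> 'b::metric_space"
  assumes "compact (\<phi> ` X)" "r > 0"
  obtains L where "\<And>n \<delta> f.
    (\<And>x y. x \<in> X \<Longrightarrow> y \<in> X \<Longrightarrow> dist (\<phi> x) (\<phi> y) < r \<Longrightarrow> hamming_dist f n x y < \<delta>) \<Longrightarrow>
    hamming_sep_number X f n \<delta> \<le> enat L"
proof -
  \<comment> \<open>Half the radius, so that two points in one ball are less than \<open>r\<close>
    apart.\<close>
  obtain P where P: "finite P" "\<phi> ` X \<subseteq> (\<Union>p\<in>P. ball p (r / 2))"
    using seq_compact_imp_totally_bounded[OF compact_imp_seq_compact[OF assms(1)]] \<open>r > 0\<close>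
    by (meson half_gt_zero)
  show thesis
  proof (rule that[of "card P"])
    fix n \<delta> f
    assume *: "\<And>x y. x \<in> X \<Longrightarrow> y \<in> X \<Longrightarrow> dist (\<phi> x) (\<phi> y) < r \<Longrightarrow> hamming_dist f n x y < \<delta>"
    show "hamming_sep_number X f n \<delta> \<le> enat (card P)"
    proof (rule hamming_sep_number_le_card_cover[OF P(1), where C = "\<lambda>p. \<phi> -` ball p (r / 2)"])
      show "X \<subseteq> (\<Union>p\<in>P. \<phi> -` ball p (r / 2))" using P(2) by blast
      fix p x y
      assume "x \<in> X \<inter> \<phi> -` ball p (r / 2)" "y \<in> X \<inter> \<phi> -` ball p (r / 2)"
      then show "hamming_dist f n x y < \<delta>"
        using * dist_triangle_half_r[of p "\<phi> x" r "\<phi> y"] by auto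
    qed
  qed
qed

text \<open>For fixed \<open>n\<close> only finitely many iterates matter; each is uniformly
  continuous, and the least of their moduli serves them all.\<close>

lemma hamming_sep_number_finite:
  assumes "compact X" "continuous_on X f" "f ` X \<subseteq> X" "\<delta> > 0" "n > 0"
  obtains L where "hamming_sep_number X f n \<delta> \<le> enat L"
proof -
  have "\<exists>d>0. \<forall>x\<in>X. \<forall>y\<in>X. dist x y < d \<longrightarrow> dist ((f ^^ i) x) ((f ^^ i) y) < \<delta>" for i
  proof -
    have "uniformly_continuous_on X (f ^^ i)"
      using assms continuous_on_funpow compact_uniformly_continuous by blast
    then show ?thesis
      using \<open>\<delta> > 0\<close> unfolding uniformly_continuous_on_def by (metis dist_commute)
  qed
  then obtain d where d: "\<And>i. d i > 0"
    "\<And>i x y. x \<in> X \<Longrightarrow> y \<in> X \<Longrightarrow> dist x y < d i \<Longrightarrow> dist ((f ^^ i) x) ((f ^^ i) y) < \<delta>"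
    by metis
  define r where "r = Min (d ` {..<n})"
  have ne: "d ` {..<n} \<noteq> {}" using \<open>n > 0\<close> by auto
  have "r > 0" unfolding r_def using ne d(1) by (subst Min_gr_iff) auto
  moreover have "compact (id ` X)" using assms(1) by simp
  ultimately obtain L where L: "\<And>n \<delta> f.
    (\<And>x y. x \<in> X \<Longrightarrow> y \<in> X \<Longrightarrow> dist (id x) (id y) < r \<Longrightarrow> hamming_dist f n x y < \<delta>) \<Longrightarrow>
    hamming_sep_number X f n \<delta> \<le> enat L"
    using hamming_sep_number_bounded_via[of id X r] by blast
  have "hamming_dist f n x y < \<delta>" if "x \<in> X" "y \<in> X" "dist (id x) (id y) < r" for x y
  proof -
    have "dist ((f ^^ i) x) ((f ^^ i) y) < \<delta>" if "i < n" for i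
    proof -
      have "r \<le> d i" unfolding r_def using that by (intro Min_le) auto
      then show ?thesis using d(2) \<open>x \<in> X\<close> \<open>y \<in> X\<close> \<open>dist (id x) (id y) < r\<close> by auto
    qed
    then have "(\<Sum>i<n. dist ((f ^^ i) x) ((f ^^ i) y)) < (\<Sum>i<n. \<delta>)"
      using \<open>n > 0\<close> by (intro sum_strict_mono) auto
    then show ?thesis
      using \<open>n > 0\<close> by (simp add: hamming_dist_def divide_less_eq mult.commute)
  qed
  then show thesis using L that by blast
qed

section \<open>Points with spread-out nearby fibres\<close>

text \<open>These open sets shrink, as \<open>\<rho>\<close> tends to 0, to the set of points whose fibre has diameter at
  least \<open>e\<close>.\<close>

definition spread_set ::
  "'a::metric_space set \<Rightarrow> ('a \<Rightarrow> 'b::metric_space) \<Rightarrow> real \<Rightarrow> real \<Rightarrow> 'b set" where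
  "spread_set X h e \<rho> =
     (\<Union>(x, y)\<in>{(x, y). x \<in> X \<and> y \<in> X \<and> e \<le> dist x y}. ball (h x) \<rho> \<inter> ball (h y) \<rho>)"

lemma spread_set_iff:
  "z \<in> spread_set X h e \<rho> \<longleftrightarrow>
    (\<exists>x\<in>X. \<exists>y\<in>X. e \<le> dist x y \<and> dist (h x) z < \<rho> \<and> dist (h y) z < \<rho>)"
  by (auto simp: spread_set_def)

lemma open_spread_set: "open (spread_set X h e \<rho>)"
  unfolding spread_set_def by (intro open_UN) auto

text \<open>If \<open>z\<close> lies in every set, compactness of \<open>X \<times> X\<close> gives
  a limit of the witnessing pairs. Its two points stay at distance at least \<open>e\<close>, and
  continuity puts both in the fibre over \<open>z\<close>, which is then not a singleton.\<close>

lemma Inter_spread_set_disjoint_singleton_fibres: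
  assumes "compact X" "continuous_on X h" "e > 0"
  shows "(\<Inter>k. spread_set X h e (1 / real (Suc k))) \<inter> singleton_fibres X Y h = {}"
proof (rule ccontr)
  assume "\<not> ?thesis"
  then obtain z where z: "\<And>k. z \<in> spread_set X h e (1 / real (Suc k))"
    and "z \<in> singleton_fibres X Y h"
    by blast
  from z have "\<exists>p. fst p \<in> X \<and> snd p \<in> X \<and> e \<le> dist (fst p) (snd p) \<and>
      dist (h (fst p)) z < 1 / real (Suc k) \<and> dist (h (snd p)) z < 1 / real (Suc k)" for k
    unfolding spread_set_iff by (metis fst_conv snd_conv)
  then obtain p where p: "\<And>k. fst (p k) \<in> X" "\<And>k. snd (p k) \<in> X"
    "\<And>k. e \<le> dist (fst (p k)) (snd (p k))"
    "\<And>k. dist (h (fst (p k))) z < 1 / real (Suc k)"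
    "\<And>k. dist (h (snd (p k))) z < 1 / real (Suc k)"
    by metis
  have "seq_compact (X \<times> X)"
    using assms(1) compact_Times compact_imp_seq_compact by blast
  moreover have "\<forall>k. p k \<in> X \<times> X" using p(1,2) by (simp add: mem_Times_iff)
  ultimately obtain l r where l: "l \<in> X \<times> X" and r: "strict_mono (r :: nat \<Rightarrow> nat)"
    and lim: "(p \<circ> r) \<longlonglongrightarrow> l"
    unfolding seq_compact_def by blast
  have lim1: "(\<lambda>k. fst (p (r k))) \<longlonglongrightarrow> fst l" and lim2: "(\<lambda>k. snd (p (r k))) \<longlonglongrightarrow> snd l"
    using tendsto_fst[OF lim] tendsto_snd[OF lim] by (simp_all add: o_def)
  have "(\<lambda>k. dist (fst (p (r k))) (snd (p (r k)))) \<longlonglongrightarrow> dist (fst l) (snd l)"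
    using lim1 lim2 by (rule tendsto_dist)
  then have "e \<le> dist (fst l) (snd l)"
    by (rule LIMSEQ_le_const) (use p(3) in auto)
  have inv: "(\<lambda>k. 1 / real (Suc (r k))) \<longlonglongrightarrow> 0"
    using LIMSEQ_subseq_LIMSEQ[OF LIMSEQ_Suc[OF lim_1_over_n] r] by (simp add: o_def)
  \<comment> \<open>The images \<open>h (q k)\<close> converge to \<open>h a\<close> by continuity
    and to \<open>z\<close> by the shrinking radii.\<close>
  have fib: "h a = z" if "a \<in> X" "q \<longlonglongrightarrow> a" "\<And>k. q k \<in> X"
      "\<And>k. dist (h (q k)) z < 1 / real (Suc (r k))" for a q
  proof -
    have "(\<lambda>k. h (q k)) \<longlonglongrightarrow> h a"
      using continuous_on_tendsto_compose[OF assms(2) that(2,1)] that(3) by simp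
    moreover have "(\<lambda>k. h (q k)) \<longlonglongrightarrow> z"
      unfolding tendsto_dist_iff[of _ z]
      by (rule Lim_null_comparison[OF _ inv]) (use that(4) in \<open>auto intro!: always_eventually less_imp_le\<close>)
    ultimately show ?thesis using LIMSEQ_unique by blast
  qed
  have "h (fst l) = z" "h (snd l) = z"
    using fib[OF _ lim1] fib[OF _ lim2] l p by (auto simp: mem_Times_iff)
  moreover have "fst l \<noteq> snd l"
    using \<open>e \<le> dist (fst l) (snd l)\<close> assms(3) by auto
  ultimately have "card {x \<in> X. h x = z} \<noteq> 1"
    using l unfolding card_1_singleton_iff One_nat_def
    by (metis (mono_tags, lifting) mem_Collect_eq mem_Times_iff singletonD)
  with \<open>z \<in> singleton_fibres X Y h\<close> show False
    by (simp add: singleton_fibres_def)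
qed

text \<open>Continuity of the measure from above: the sets decrease, and their intersection misses a
  set of measure 1.\<close>

lemma measure_spread_set_small:
  assumes "compact X" "continuous_on X h" "e > 0" "\<epsilon> > 0"
    and M: "prob_space M" "sets M = sets (restrict_space borel Y)"
    and full: "measure M (singleton_fibres X Y h) = 1"
  obtains \<rho> where "\<rho> > 0" "measure M (Y \<inter> spread_set X h e \<rho>) < \<epsilon>"
proof -
  interpret prob_space M by fact
  define A where "A k = Y \<inter> spread_set X h e (1 / real (Suc k))" for k
  have A: "A k \<in> sets M" for k
    unfolding A_def M(2) sets_restrict_space by (intro imageI borel_open open_spread_set)
  have "decseq A"
    unfolding decseq_def A_def
  proof (intro allI impI subsetI)
    fix m n z assume "m \<le> (n::nat)" and z: "z \<in> Y \<inter> spread_set X h e (1 / real (Suc n))"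
    have "1 / real (Suc n) \<le> 1 / real (Suc m)"
      using \<open>m \<le> n\<close> by (intro divide_left_mono) auto
    with z show "z \<in> Y \<inter> spread_set X h e (1 / real (Suc m))"
      unfolding spread_set_iff Int_iff by (meson less_le_trans)
  qed
  then have lim: "(\<lambda>k. prob (A k)) \<longlonglongrightarrow> prob (\<Inter>k. A k)"
    using A by (intro finite_Lim_measure_decseq) auto
  \<comment> \<open>A set outside the sigma-algebra has measure 0 by convention, so measure 1
    already forces measurability.\<close>
  have meas: "singleton_fibres X Y h \<in> events"
    using full measure_notin_sets by force
  have "(\<Inter>k. A k) \<inter> singleton_fibres X Y h = {}"
    using Inter_spread_set_disjoint_singleton_fibres[OF assms(1-3), of Y] unfolding A_def by blast
  then have "prob ((\<Inter>k. A k) \<union> singleton_fibres X Y h) = prob (\<Inter>k. A k) + 1"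
    using finite_measure_Union[of "\<Inter>k. A k" "singleton_fibres X Y h"] meas A full by auto
  then have "prob (\<Inter>k. A k) = 0"
    using prob_le_1[of "(\<Inter>k. A k) \<union> singleton_fibres X Y h"] measure_nonneg[of M "\<Inter>k. A k"]
    by linarith
  with lim have "eventually (\<lambda>k. prob (A k) < \<epsilon>) sequentially"
    using \<open>\<epsilon> > 0\<close> by (auto intro: order_tendstoD)
  then obtain k where "prob (A k) < \<epsilon>"
    by (auto simp: eventually_sequentially)
  then show thesis
    by (intro that[of "1 / real (Suc k)"]) (auto simp: A_def)
qed

section \<open>Counting the times at which orbits are far apart\<close>

text \<open>Each time costs less than \<open>e\<close> or at most \<open>D\<close>, and the second
  kind occurs at most \<open>c\<close> times.\<close>

lemma hamming_dist_le_card: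
  assumes "n > 0" "e \<ge> 0" "D \<ge> 0"
    and D: "\<And>i. dist ((f ^^ i) x) ((f ^^ i) y) \<le> D"
    and c: "real (card {i. i < n \<and> e \<le> dist ((f ^^ i) x) ((f ^^ i) y)}) \<le> c"
  shows "hamming_dist f n x y \<le> e + D * c / real n"
proof -
  let ?T = "{i. i < n \<and> e \<le> dist ((f ^^ i) x) ((f ^^ i) y)}"
  have "(\<Sum>i<n. dist ((f ^^ i) x) ((f ^^ i) y)) \<le> (\<Sum>i<n. e + (if i \<in> ?T then D else 0))"
    by (rule sum_mono) (use D assms(2) in \<open>auto simp: add_increasing\<close>)
  also have "\<dots> = real n * e + (\<Sum>i<n. if i \<in> ?T then D else 0)"
    by (simp add: sum.distrib)
  also have "(\<Sum>i<n. if i \<in> ?T then D else 0) = (\<Sum>i\<in>?T. D)"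
    by (rule sum.mono_neutral_cong_right) auto
  also have "\<dots> \<le> D * c"
    using c assms(3) by (simp add: mult.commute mult_left_mono)
  finally show ?thesis
    using \<open>n > 0\<close> by (simp add: hamming_dist_def field_simps)
qed

text \<open>Shifting by \<open>k\<close> moves the counted times into \<open>{k..<n + k}\<close>, of
  which at most \<open>k\<close> lie at or beyond \<open>n\<close>.\<close>

lemma card_shifted_visits_le:
  "card {i. i < n \<and> P (i + k)} \<le> card {i. i < n \<and> P i} + k"
proof -
  have "card {i. i < n \<and> P (i + k)} = card ((\<lambda>i. i + k) ` {i. i < n \<and> P (i + k)})"
    by (simp add: card_image)
  also have "\<dots> \<le> card ({i. i < n \<and> P i} \<union> {n..<n + k})"
    by (rule card_mono) auto
  also have "\<dots> \<le> card {i. i < n \<and> P i} + card {n..<n + k}"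
    by (rule card_Un_le)
  finally show ?thesis by simp
qed

section \<open>Bounded separation numbers and vanishing entropy\<close>

theorem theorem6p1:
  fixes X :: "'a::metric_space set" and f :: "'a \<Rightarrow> 'a"
    and \<Xi> :: "'b::metric_space set" and \<tau> :: "'b \<Rightarrow> 'b"
    and h :: "'a \<Rightarrow> 'b" and \<mu> :: "'b measure"
  assumes "compact X" and "compact \<Xi>"
    and "self_homeomorphism \<Xi> \<tau>"
    and "minimal_on \<Xi> \<tau>"
    and "equicontinuous_map_on \<Xi> \<tau>"
    and "invariant_borel_prob \<Xi> \<tau> \<mu>"
    and "self_homeomorphism X f"
    and "regular_almost_1_1_extension X f \<Xi> \<tau> \<mu> h"
  shows "(\<forall>\<delta>>0. (SUP n\<in>{1..}. hamming_sep_number X f n \<delta>) < \<infinity>)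
         \<and> has_mod_power_entropy X f 0"
proof -
  note \<tau> = self_homeomorphismD[OF assms(3)]
  note f = self_homeomorphismD[OF assms(7)]
  have h: "continuous_on X h" "h ` X = \<Xi>" "\<And>x. x \<in> X \<Longrightarrow> h (f x) = \<tau> (h x)"
    and full: "measure \<mu> (singleton_fibres X \<Xi> h) = 1"
    using assms(8)
    by (auto simp: regular_almost_1_1_extension_def almost_1_1_extension_def factor_map_def)
  have \<mu>: "prob_space \<mu>" "sets \<mu> = sets (restrict_space borel \<Xi>)" "distr \<mu> \<mu> \<tau> = \<mu>"
    using assms(6) by (auto simp: invariant_borel_prob_def)
  have sp: "space \<mu> = \<Xi>"
    using sets_eq_imp_space_eq[OF \<mu>(2)] by (simp add: space_restrict_space)
  have "\<tau> \<in> measurable \<mu> (restrict_space borel \<Xi>)"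
    using borel_measurable_continuous_on_restrict[OF \<tau>(1)] \<tau>(2)
    by (auto simp: measurable_restrict_space2_iff measurable_cong_sets[OF \<mu>(2) refl]
        space_restrict_space)
  then have meas: "\<tau> \<in> measurable \<mu> \<mu>"
    by (simp add: measurable_cong_sets[OF refl \<mu>(2)])
  have hf: "h ((f ^^ i) x) = (\<tau> ^^ i) (h x)" if "x \<in> X" for i x
    using that by (induction i) (auto simp: h(3) funpow_mem[OF f(2)])

  \<comment> \<open>The radius \<open>r\<close> is chosen before \<open>n\<close>, so a single cover
    of \<Xi> serves all large \<open>n\<close>.\<close>
  have large: "\<exists>N r. r > 0 \<and> (\<forall>n\<ge>N. \<forall>x\<in>X. \<forall>y\<in>X. dist (h x) (h y) < r \<longrightarrow> hamming_dist f n x y < \<delta>)"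
    if "\<delta> > 0" for \<delta>
  proof -
    obtain D where "D > 0" and D: "\<And>x y. x \<in> X \<Longrightarrow> y \<in> X \<Longrightarrow> dist x y \<le> D"
    proof -
      \<comment> \<open>Adding 1 to the diameter keeps \<open>D\<close> positive, as it becomes a
        divisor below.\<close>
      have "\<And>x y. x \<in> X \<Longrightarrow> y \<in> X \<Longrightarrow> dist x y \<le> diameter X + 1"
        using diameter_bounded_bound[OF compact_imp_bounded[OF assms(1)]] by (simp add: add_increasing2)
      moreover have "diameter X + 1 > 0"
        using diameter_ge_0[OF compact_imp_bounded[OF assms(1)]] by simp
      ultimately show thesis using that by blast
    qed
    \<comment> \<open>The budget is three terms of \<delta>/4: the times when the orbits are close,
      the visits to \<open>B\<close>, and the delay of at most \<open>K\<close>.\<close>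
    have "\<delta> / 4 > 0" "\<delta> / (4 * D) > 0" using \<open>\<delta> > 0\<close> \<open>D > 0\<close> by auto
    then obtain \<rho> where "\<rho> > 0" and \<rho>: "measure \<mu> (\<Xi> \<inter> spread_set X h (\<delta> / 4) \<rho>) < \<delta> / (4 * D)"
      using measure_spread_set_small[OF assms(1) h(1) _ _ \<mu>(1,2) full] by metis
    define B where "B = \<Xi> \<inter> spread_set X h (\<delta> / 4) \<rho>"
    have B: "B \<in> sets \<mu>"
      unfolding B_def \<mu>(2) sets_restrict_space by (intro imageI borel_open open_spread_set)
    \<comment> \<open>Half of \<rho> is for shadowing \<open>h x\<close>, the other half for passing
      from \<open>h x\<close> to \<open>h y\<close>.\<close>
    have "\<rho> / 2 > 0" using \<open>\<rho> > 0\<close> by simp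
    obtain r where "r > 0"
      and r: "\<And>x y. x \<in> \<Xi> \<Longrightarrow> y \<in> \<Xi> \<Longrightarrow> dist x y < r \<Longrightarrow> orbit_close \<tau> (\<rho> / 2) x y"
      using equicontinuous_map_on_uniform[OF assms(2,5) \<open>\<rho> / 2 > 0\<close>] by blast
    obtain K where K: "\<And>x y. x \<in> \<Xi> \<Longrightarrow> y \<in> \<Xi> \<Longrightarrow> \<exists>k\<le>K. orbit_close \<tau> (\<rho> / 2) ((\<tau> ^^ k) x) y"
      using minimal_equicontinuous_uniform_return[OF assms(2,4,5) \<tau> \<open>\<rho> / 2 > 0\<close>] by blast
    obtain N where N: "real N > 4 * D * real K / \<delta>" using reals_Archimedean2 by blast
    \<comment> \<open>\<open>Suc N\<close> rather than \<open>N\<close> ensures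
      \<open>n > 0\<close>, so that dividing by \<open>n\<close> is meaningful.\<close>
    have "hamming_dist f n x y < \<delta>"
      if "n \<ge> Suc N" "x \<in> X" "y \<in> X" "dist (h x) (h y) < r" for n x y
    proof -
      have hx: "h x \<in> \<Xi>" and hy: "h y \<in> \<Xi>" using that(2,3) h(2) by auto
      \<comment> \<open>The point \<xi> varies with \<open>n\<close>, which is harmless because
        \<open>K\<close> is uniform over \<Xi>.\<close>
      obtain \<xi> where \<xi>: "\<xi> \<in> \<Xi>" "real (card {i. i < n \<and> (\<tau> ^^ i) \<xi> \<in> B}) \<le> real n * measure \<mu> B"
        using prob_space.exists_visit_count_le_measure[OF \<mu>(1) meas \<mu>(3) B] sp by metis
      obtain k where "k \<le> K" and k: "orbit_close \<tau> (\<rho> / 2) ((\<tau> ^^ k) \<xi>) (h x)"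
        using K[OF \<xi>(1) hx] by blast
      have ky: "orbit_close \<tau> \<rho> ((\<tau> ^^ k) \<xi>) (h y)"
        using orbit_close_trans[OF k r[OF hx hy that(4)], of \<rho>] by simp
      \<comment> \<open>The pair \<open>(f ^^ i) x\<close>, \<open>(f ^^ i) y\<close> is itself the
        witness: both images lie within \<rho> of the shadowing point at time
        \<open>i + k\<close>.\<close>
      have visit: "(\<tau> ^^ (i + k)) \<xi> \<in> B" if "\<delta> / 4 \<le> dist ((f ^^ i) x) ((f ^^ i) y)" for i
      proof -
        have "dist (h ((f ^^ i) x)) ((\<tau> ^^ (i + k)) \<xi>) < \<rho>"
          using orbit_closeD[OF k, of i] \<open>\<rho> > 0\<close> hf[OF \<open>x \<in> X\<close>]
          by (simp add: funpow_add dist_commute)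
        moreover have "dist (h ((f ^^ i) y)) ((\<tau> ^^ (i + k)) \<xi>) < \<rho>"
          using orbit_closeD[OF ky, of i] hf[OF \<open>y \<in> X\<close>]
          by (simp add: funpow_add dist_commute)
        ultimately show ?thesis
          unfolding B_def Int_iff spread_set_iff
          using that funpow_mem[OF f(2)] \<open>x \<in> X\<close> \<open>y \<in> X\<close> funpow_mem[OF \<tau>(2) \<xi>(1)] by blast
      qed
      have "card {i. i < n \<and> \<delta> / 4 \<le> dist ((f ^^ i) x) ((f ^^ i) y)}
          \<le> card {i. i < n \<and> (\<tau> ^^ (i + k)) \<xi> \<in> B}"
        by (rule card_mono) (use visit in auto)
      also have "\<dots> \<le> card {i. i < n \<and> (\<tau> ^^ i) \<xi> \<in> B} + k"
        by (rule card_shifted_visits_le)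
      finally have "real (card {i. i < n \<and> \<delta> / 4 \<le> dist ((f ^^ i) x) ((f ^^ i) y)})
          \<le> real (card {i. i < n \<and> (\<tau> ^^ i) \<xi> \<in> B}) + real K"
        using \<open>k \<le> K\<close> by linarith
      also have "\<dots> \<le> real n * measure \<mu> B + real K" using \<xi>(2) by simp
      finally have "hamming_dist f n x y \<le> \<delta> / 4 + D * (real n * measure \<mu> B + real K) / real n"
        using that(1) \<open>\<delta> > 0\<close> \<open>D > 0\<close> D funpow_mem[OF f(2)] \<open>x \<in> X\<close> \<open>y \<in> X\<close>
        by (intro hamming_dist_le_card) auto
      also have "\<dots> = \<delta> / 4 + D * measure \<mu> B + D * real K / real n"
        using that(1) by (simp add: field_simps)
      also have "D * measure \<mu> B < \<delta> / 4"
        using \<rho> \<open>D > 0\<close> by (simp add: B_def field_simps)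
      also have "D * real K / real n < \<delta> / 4"
      proof -
        have "4 * D * real K / \<delta> < real n" using N that(1) by linarith
        then show ?thesis using \<open>\<delta> > 0\<close> that(1) by (simp add: field_simps)
      qed
      finally show ?thesis using \<open>\<delta> > 0\<close> by simp
    qed
    then show ?thesis using \<open>r > 0\<close> by blast
  qed

  have bounded: "\<exists>L. \<forall>n\<ge>1. hamming_sep_number X f n \<delta> \<le> enat L" if "\<delta> > 0" for \<delta>
  proof -
    obtain N r where "r > 0" and
      N: "\<And>n x y. n \<ge> N \<Longrightarrow> x \<in> X \<Longrightarrow> y \<in> X \<Longrightarrow> dist (h x) (h y) < r \<Longrightarrow> hamming_dist f n x y < \<delta>"
      using large[OF \<open>\<delta> > 0\<close>] by blast
    have "compact (h ` X)" using h(2) assms(2) by simp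
    then obtain L where "\<And>n \<delta> f.
      (\<And>x y. x \<in> X \<Longrightarrow> y \<in> X \<Longrightarrow> dist (h x) (h y) < r \<Longrightarrow> hamming_dist f n x y < \<delta>) \<Longrightarrow>
      hamming_sep_number X f n \<delta> \<le> enat L"
      using hamming_sep_number_bounded_via[OF _ \<open>r > 0\<close>] by blast
    then have L: "hamming_sep_number X f n \<delta> \<le> enat L" if "n \<ge> N" for n
      using N that by blast
    have "\<exists>l. hamming_sep_number X f n \<delta> \<le> enat l" if "n > 0" for n
      using hamming_sep_number_finite[OF assms(1) f \<open>\<delta> > 0\<close> that] by blast
    then obtain l where l: "\<And>n. n > 0 \<Longrightarrow> hamming_sep_number X f n \<delta> \<le> enat (l n)" by metis
    \<comment> \<open>\<open>L\<close> handles \<open>n \<ge> N\<close>; the sum dominates the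
      separate bounds for the finitely many smaller \<open>n\<close>.\<close>
    have "hamming_sep_number X f n \<delta> \<le> enat (L + (\<Sum>i<N. l i))" if "n \<ge> 1" for n
    proof (cases "n \<ge> N")
      case True
      then show ?thesis using L[OF True] by (meson enat_ord_simps(1) le_add1 order_trans)
    next
      case False
      then have "l n \<le> (\<Sum>i<N. l i)" by (intro member_le_sum) auto
      then have "enat (l n) \<le> enat (L + (\<Sum>i<N. l i))" by simp
      moreover have "hamming_sep_number X f n \<delta> \<le> enat (l n)" using l that by simp
      ultimately show ?thesis by (rule order_trans[rotated])
    qed
    then show ?thesis by blast
  qed

  have "(SUP n\<in>{1..}. hamming_sep_number X f n \<delta>) < \<infinity>" if "\<delta> > 0" for \<delta>
  proof -
    obtain L where "\<forall>n\<ge>1. hamming_sep_number X f n \<delta> \<le> enat L" using bounded[OF \<open>\<delta> > 0\<close>] by blast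
    then have "(SUP n\<in>{1..}. hamming_sep_number X f n \<delta>) \<le> enat L"
      by (intro SUP_least) auto
    also have "\<dots> < \<infinity>" by simp
    finally show ?thesis .
  qed
  moreover have "(\<lambda>n. ln_enat (hamming_sep_number X f n \<delta>) / ereal (ln (real n))) \<longlonglongrightarrow> 0"
    if "\<delta> > 0" for \<delta>
  proof -
    obtain L where L: "\<And>n. n \<ge> 1 \<Longrightarrow> hamming_sep_number X f n \<delta> \<le> enat L"
      using bounded[OF \<open>\<delta> > 0\<close>] by blast
    define s where "s n = the_enat (hamming_sep_number X f n \<delta>)" for n
    have s: "hamming_sep_number X f n \<delta> = enat (s n)" "s n \<le> L" if "n \<ge> 1" for n
    proof -
      show eq: "hamming_sep_number X f n \<delta> = enat (s n)"
        using L[OF that] unfolding s_def by (metis enat_ile the_enat.simps)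
      show "s n \<le> L" using L[OF that] eq by simp
    qed
    \<comment> \<open>For \<open>m = 0\<close> this rests on the convention that \<open>ln 0\<close>
      is 0.\<close>
    have ln_nat_nonneg: "ln (real m) \<ge> 0" for m
      by (cases m) auto
    have upper: "(\<lambda>n. ln (real (Suc L)) / ln (real n)) \<longlonglongrightarrow> 0"
      by (intro tendsto_divide_0[OF tendsto_const] filterlim_at_top_imp_at_infinity
          filterlim_compose[OF ln_at_top filterlim_real_sequentially])
    have "(\<lambda>n. ln (real (s n)) / ln (real n)) \<longlonglongrightarrow> 0"
    proof (rule tendsto_sandwich[OF _ _ tendsto_const upper])
      show "\<forall>\<^sub>F n in sequentially. 0 \<le> ln (real (s n)) / ln (real n)"
        using ln_nat_nonneg by simp
      show "\<forall>\<^sub>F n in sequentially. ln (real (s n)) / ln (real n) \<le> ln (real (Suc L)) / ln (real n)"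
        using eventually_ge_at_top[of 1]
      proof eventually_elim
        case (elim n)
        have "ln (real (s n)) \<le> ln (real (Suc L))"
        proof (cases "s n = 0")
          case False
          then show ?thesis using s(2)[OF elim] by (subst ln_le_cancel_iff) auto
        qed (use ln_nat_nonneg[of "Suc L"] in simp)
        then show ?case using ln_nat_nonneg by (intro divide_right_mono)
      qed
    qed
    then have "(\<lambda>n. ereal (ln (real (s n)) / ln (real n))) \<longlonglongrightarrow> 0"
      by (simp add: zero_ereal_def)
    \<comment> \<open>Restricting to \<open>n > 1\<close> makes the denominator nonzero, so extended
      division agrees with real division.\<close>
    moreover have "\<forall>\<^sub>F n in sequentially. ereal (ln (real (s n)) / ln (real n))
        = ln_enat (hamming_sep_number X f n \<delta>) / ereal (ln (real n))"
      using eventually_gt_at_top[of 1]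
    proof eventually_elim
      case (elim n)
      then have "ln (real n) \<noteq> 0" by simp
      then show ?case using s(1)[of n] elim by (simp add: ln_enat_def)
    qed
    ultimately show ?thesis by (rule Lim_transform_eventually)
  qed
  then have "has_mod_power_entropy X f 0"
    unfolding has_mod_power_entropy_def by (intro exI[of _ "\<lambda>_. 0"]) auto
  ultimately show ?thesis by blast
qed

end
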